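(* Let $\mathbf A=(A,\vee,r,\rightarrow,1)$ be an I-algebra. Define $x\wedge y:=r(x,y,z)$ for all $x,y,z\in A$ with $z\leq x,y$ (and leave $x\wedge y$ undefined if $x$ and $y$ have no common lower bound). Then $\wedge$ is well-defined (i.e. $r(x,y,z)$ does not depend on the choice of the common lower bound $z$ of $x$ and $y$), and $\mathbb J(\mathbf A):=(A,\vee,\wedge,\rightarrow,1)$ is a non-classical implication semilattice.
   Context: In a join-semilattice $(S,\vee,1)$ with top element $1$, the order is $x\leq y$ iff $x\vee y=y$. An I-algebra is an algebra $(A,\vee,r,\rightarrow,1)$ of type $(2,3,2,0)$ such that $(A,\vee,1)$ is a join-semilattice with top element $1$ and for all $x,y,z,u\in A$: (1') $y\leq x\rightarrow y$; (2') $r(x,x\rightarrow y,y)=y$; (3') $(x\vee y)\rightarrow y=x\rightarrow y$; (4') $y\leq(x\vee z)\rightarrow r(x,y,z)$; (5') $r(x,y,z)\leq x\vee z$; (6') $r(x,y,z)\leq y\vee z$; (7') $r(x,x\vee y,z)=x\vee z$; (8') $r(x,y,z)=r(x\vee z,y\vee z,z)$; (9') $z\leq r(x,y,z)$; (10') $r(u,r(x,y,z),z)=r(r(u,x,z),r(u,y,z),z)$. A non-classical implication semilattice is a quintuple $(S,\vee,\wedge,\rightarrow,1)$ where $(S,\vee,1)$ is a join-semilattice with top element $1$, $\wedge$ is the partial operation of infimum, $x\wedge y$ exists if and only if $x$ and $y$ have a common lower bound, and $\rightarrow$ is a binary operation on $S$ such that for all $x,y,z\in S$: (1) $y\leq x\rightarrow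 y$; (2) $(x\vee y)\wedge(x\rightarrow y)=y$; (3) $(x\vee y)\rightarrow y=x\rightarrow y$; (4) $y\leq(x\vee z)\rightarrow\big((x\vee z)\wedge(y\vee z)\big)$. *)

theory Defs
  imports Main
begin

text \<open>
  The carrier of an algebra is the whole type \<open>'a\<close>. The library locale \<open>semilattice\<close> says that
  \<open>join\<close> is associative, commutative and idempotent.
\<close>

definition join_le :: "('a \<Rightarrow> 'a \<Rightarrow> 'a) \<Rightarrow> 'a \<Rightarrow> 'a \<Rightarrow> bool" where
  "join_le join x y \<longleftrightarrow> join x y = y"

definition common_lower_bound :: "('a \<Rightarrow> 'a \<Rightarrow> 'a) \<Rightarrow> 'a \<Rightarrow> 'a \<Rightarrow> 'a \<Rightarrow> bool" where
  "common_lower_bound join x y z \<longleftrightarrow> join_le join z x \<and> join_le join z y"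

definition is_infimum :: "('a \<Rightarrow> 'a \<Rightarrow> 'a) \<Rightarrow> 'a \<Rightarrow> 'a \<Rightarrow> 'a \<Rightarrow> bool" where
  "is_infimum join x y m \<longleftrightarrow>
     common_lower_bound join x y m \<and> (\<forall>z. common_lower_bound join x y z \<longrightarrow> join_le join z m)"

locale join_semilattice_top = semilattice join
  for join :: "'a \<Rightarrow> 'a \<Rightarrow> 'a" (infixl "\<squnion>" 65) and one :: 'a +
  assumes le_one: "join_le join x one"

locale I_algebra = join_semilattice_top join one
  for join :: "'a \<Rightarrow> 'a \<Rightarrow> 'a" (infixl "\<squnion>" 65)
    and r :: "'a \<Rightarrow> 'a \<Rightarrow> 'a \<Rightarrow> 'a"
    and imp :: "'a \<Rightarrow> 'a \<Rightarrow> 'a" (infixr "\<rightarrow>" 60)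
    and one :: 'a +
  assumes I1: "join_le join y (x \<rightarrow> y)"
    and I2: "r x (x \<rightarrow> y) y = y"
    and I3: "(x \<squnion> y) \<rightarrow> y = x \<rightarrow> y"
    and I4: "join_le join y ((x \<squnion> z) \<rightarrow> r x y z)"
    and I5: "join_le join (r x y z) (x \<squnion> z)"
    and I6: "join_le join (r x y z) (y \<squnion> z)"
    and I7: "r x (x \<squnion> y) z = x \<squnion> z"
    and I8: "r x y z = r (x \<squnion> z) (y \<squnion> z) z"
    and I9: "join_le join z (r x y z)"
    and I10: "r u (r x y z) z = r (r u x z) (r u y z) z"

text \<open>
  The partial operation \<open>meet\<close> is option-valued, with \<open>None\<close> for undefined. \<open>meet_infimum\<close> makes it
  the partial operation of infimum and \<open>meet_defined\<close> fixes its domain. An identity containing a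
  meet asserts in particular that this meet is defined.
\<close>

locale nonclassical_implication_semilattice = join_semilattice_top join one
  for join :: "'a \<Rightarrow> 'a \<Rightarrow> 'a" (infixl "\<squnion>" 65)
    and meet :: "'a \<Rightarrow> 'a \<Rightarrow> 'a option" (infixl "\<sqinter>" 70)
    and imp :: "'a \<Rightarrow> 'a \<Rightarrow> 'a" (infixr "\<rightarrow>" 60)
    and one :: 'a +
  assumes meet_infimum: "x \<sqinter> y = Some m \<longleftrightarrow> is_infimum join x y m"
    and meet_defined: "x \<sqinter> y \<noteq> None \<longleftrightarrow> (\<exists>z. common_lower_bound join x y z)"
    and N1: "join_le join y (x \<rightarrow> y)"
    and N2: "(x \<squnion> y) \<sqinter> (x \<rightarrow> y) = Some y"
    and N3: "(x \<squnion> y) \<rightarrow> y = x \<rightarrow> y"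
    and N4: "\<exists>m. (x \<squnion> z) \<sqinter> (y \<squnion> z) = Some m \<and> join_le join y ((x \<squnion> z) \<rightarrow> m)"

text \<open>
  The meet of \<open>J(A)\<close>: the value \<open>r x y z\<close> at some common lower bound \<open>z\<close>. That the choice
  of \<open>z\<close> is irrelevant is not built in here.
\<close>

definition J_meet ::
  "('a \<Rightarrow> 'a \<Rightarrow> 'a) \<Rightarrow> ('a \<Rightarrow> 'a \<Rightarrow> 'a \<Rightarrow> 'a) \<Rightarrow> 'a \<Rightarrow> 'a \<Rightarrow> 'a option" where
  "J_meet join r x y =
     (if \<exists>z. common_lower_bound join x y z
      then Some (r x y (SOME z. common_lower_bound join x y z))
      else None)"

end

theory Submission
  imports Defs
begin

text \<open>
  For \<open>z \<le> x, y\<close> the element \<open>r x y z\<close> is the infimum of \<open>x\<close> and \<open>y\<close>, hence independent of \<open>z\<close>.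
  It is a lower bound by (5') and (6'). If \<open>w\<close> is another one, put \<open>v = w \<squnion> z\<close>. Then (7') gives
  \<open>r v x z = r v y z = r v v z = v\<close>, so \<open>r v (r x y z) z = v\<close> by (10'), whence \<open>w \<le> v \<le> r x y z\<close>
  by (6') and (9').
\<close>

context join_semilattice_top
begin

lemma infimum_unique:
  assumes "is_infimum join x y m" and "is_infimum join x y n"
  shows "m = n"
  using assms unfolding is_infimum_def join_le_def by (metis commute)

lemma join_le_imp_join_eq: "join_le join x y \<Longrightarrow> y \<squnion> x = y"
  unfolding join_le_def by (simp add: commute)

lemma common_lower_bound_of_joins: "common_lower_bound join (x \<squnion> z) (y \<squnion> z) z"
  unfolding common_lower_bound_def join_le_def by (simp add: left_commute)

end

context I_algebra
begin

text \<open>When \<open>z \<le> x \<le> y\<close>, both joins in (7') collapse: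
  \<open>x \<squnion> y = y\<close> and \<open>x \<squnion> z = x\<close>.\<close>

lemma r_absorb:
  assumes "join_le join z x" and "join_le join x y"
  shows "r x y z = x"
  using I7[of x y z] assms join_le_imp_join_eq[of z x] by (simp add: join_le_def)

lemma r_infimum:
  assumes z: "common_lower_bound join x y z"
  shows "is_infimum join x y (r x y z)"
  unfolding is_infimum_def
proof (intro conjI allI impI)
  have zx: "x \<squnion> z = x" and zy: "y \<squnion> z = y"
    using z by (simp_all add: common_lower_bound_def join_le_imp_join_eq)
  show "common_lower_bound join x y (r x y z)"
    using I5[of x y z] I6[of x y z] zx zy by (simp add: common_lower_bound_def)
next
  fix w assume w: "common_lower_bound join x y w"
  define v where "v = w \<squnion> z"
  have zv: "join_le join z v"
    unfolding v_def join_le_def by (simp add: left_commute)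
  have vx: "join_le join v x" and vy: "join_le join v y"
    using z w unfolding v_def common_lower_bound_def join_le_def by (simp_all add: assoc)
  have vv: "join_le join v v"
    by (simp add: join_le_def)
  have "r v (r x y z) z = v"
    using I10[of v x y z] r_absorb[OF zv vx] r_absorb[OF zv vy] r_absorb[OF zv vv] by simp
  then have "join_le join v (r x y z)"
    using I6[of v "r x y z" z] join_le_imp_join_eq[OF I9[of z x y]] by simp
  then show "join_le join w (r x y z)"
    unfolding v_def join_le_def by (metis assoc left_idem)
qed

text \<open>Whichever bound \<open>SOME\<close> picks, \<open>r\<close> yields an infimum there, and
  infima are unique. With no common lower bound both sides fail, since an infimum would itself be
  one.\<close>

lemma J_meet_eq_Some_iff: "J_meet join r x y = Some m \<longleftrightarrow> is_infimum join x y m"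
proof (cases "\<exists>z. common_lower_bound join x y z")
  case True
  then have "is_infimum join x y (r x y (SOME z. common_lower_bound join x y z))"
    by (rule r_infimum[OF someI_ex])
  then show ?thesis
    using True infimum_unique[of x y] by (metis J_meet_def option.inject)
next
  case False
  then show ?thesis
    by (auto simp: J_meet_def is_infimum_def)
qed

text \<open>Removes the choice operator: a meet can be evaluated at whichever common lower bound
  suits the axiom at hand.\<close>

lemma J_meet_eq_r:
  "common_lower_bound join x y z \<Longrightarrow> J_meet join r x y = Some (r x y z)"
  by (simp add: J_meet_eq_Some_iff r_infimum)

lemma J_nonclassical_implication_semilattice:
  "nonclassical_implication_semilattice join (J_meet join r) imp one"
proof unfold_locales
  fix x y z m
  show "J_meet join r x y = Some m \<longleftrightarrow> is_infimum join x y m"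
    by (rule J_meet_eq_Some_iff)
  show "J_meet join r x y \<noteq> None \<longleftrightarrow> (\<exists>z. common_lower_bound join x y z)"
    by (simp add: J_meet_def)
  show "join_le join y (x \<rightarrow> y)"
    by (rule I1)
  have "common_lower_bound join (x \<squnion> y) (x \<rightarrow> y) y"
    using I1[of y x] by (simp add: common_lower_bound_def join_le_def left_commute)
  \<comment> \<open>The meet is evaluated at the bound \<open>y\<close>. Taking (2') at
    \<open>x \<squnion> y\<close> gives the right first argument, and (3') turns its implication
    into \<open>x \<rightarrow> y\<close>.\<close>
  then show "J_meet join r (x \<squnion> y) (x \<rightarrow> y) = Some y"
    using J_meet_eq_r I2[of "x \<squnion> y" y] by (simp add: I3)
  show "x \<squnion> y \<rightarrow> y = x \<rightarrow> y"
    by (rule I3)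
  \<comment> \<open>At the bound \<open>z\<close> the meet is
    \<open>r (x \<squnion> z) (y \<squnion> z) z\<close>; (8') read from right to left makes it
    \<open>r x y z\<close>, the term in (4').\<close>
  show "\<exists>m. J_meet join r (x \<squnion> z) (y \<squnion> z) = Some m \<and> join_le join y (x \<squnion> z \<rightarrow> m)"
    using J_meet_eq_r[OF common_lower_bound_of_joins[of x z y]] I4[of y x z]
    by (simp flip: I8)
qed

end

theorem theorem5p3:
  fixes join :: "'a \<Rightarrow> 'a \<Rightarrow> 'a" and r :: "'a \<Rightarrow> 'a \<Rightarrow> 'a \<Rightarrow> 'a"
    and imp :: "'a \<Rightarrow> 'a \<Rightarrow> 'a" and one :: 'a
  assumes "I_algebra join r imp one"
  shows "(\<forall>x y z w. common_lower_bound join x y z \<longrightarrow> common_lower_bound join x y w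
            \<longrightarrow> r x y z = r x y w)
       \<and> nonclassical_implication_semilattice join (J_meet join r) imp one"
proof -
  interpret I_algebra join r imp one
    by (rule assms)
  show ?thesis
    using J_nonclassical_implication_semilattice by (blast intro: infimum_unique r_infimum)
qed

end
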